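(* The amplitudes $\rho$ of the $T$-periodic orbits of the reduced dynamics $$\dot\rho=a(\rho)+\varepsilon\left(f_1(\rho,\Omega)\cos\psi+f_2(\rho,\Omega)\sin\psi\right),\qquad \dot\psi=(b(\rho)-\Omega)+\frac{\varepsilon}{\rho}\left(g_1(\rho,\Omega)\cos\psi-g_2(\rho,\Omega)\sin\psi\right),$$ with $a,b,f_1,f_2,g_1,g_2$ as in the context, are given by the zeros of the function $$G(\rho;\Omega)=(b(\rho)-\Omega)\rho+\varepsilon\left(g_1(\rho,\Omega)\frac{1-K^\pm(\rho;\Omega)^2}{1+K^\pm(\rho;\Omega)^2}-g_2(\rho,\Omega)\frac{2K^\pm(\rho;\Omega)}{1+K^\pm(\rho;\Omega)^2}\right)=0,$$ where $$K^\pm(\rho;\Omega)=\frac{-\varepsilon f_2(\rho,\Omega)\pm\sqrt{\varepsilon^2\left(f_1(\rho,\Omega)^2+f_2(\rho,\Omega)^2\right)-a(\rho)^2}}{a(\rho)-\varepsilon f_1(\rho,\Omega)}.$$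
   Context: Consider an $n$-degree-of-freedom mechanical system $M\ddot y+C\dot y+Ky+g(y,\dot y)=\varepsilon f(\Omega t)$, $0\le\varepsilon\ll1$, with $M$ symmetric positive definite, $C$ and $K$ symmetric, $g$ analytic and of at least quadratic order, and $f$ a periodic forcing with frequency $\Omega$ and phase $\phi=\Omega t$. Its first-order form has a semisimple linear part with eigenvalues $\lambda_1,\dots,\lambda_{2n}$, all with negative real part. Let $\mathcal E$ be the two-dimensional modal subspace spanned by the eigenvectors belonging to $\lambda_1$ and $\lambda_2=\bar\lambda_1$. The spectral submanifold (SSM) over $\mathcal E$ is the two-dimensional time-periodic invariant manifold that perturbs smoothly from $\mathcal E$ at the origin under the addition of the $O(\varepsilon)$ terms and is strictly smoother than any other invariant manifold with this property. It exists and is unique and analytic if $p\,\mathrm{Re}\lambda_1+q\,\mathrm{Re}\lambda_2\ne\mathrm{Re}\lambda_l$ for all $l=3,\dots,2n$ and all non-negative integers $p,q$ with $2\le p+q\le\Sigma$, where $\Sigma$ is the integer part of $\min_{1\le j\le 2n}\mathrm{Re}\lambda_j/\max_{j=1,2}\mathrm{Re}\lambda_j$. The dynamics on the SSM, in parameterization coordinates $(s_1,s_2)$ with $s_2=\bar s_1$, is approximated to order $2M+1$ in $s$ and to first order in $\varepsilon$ by $$\dot s_1=\lambda_1s_1+\sum_{i=1}^M\gamma_is_1^{i+1}s_2^i+\varepsilon\Big(c_{1,\mathbf 0}e^{\mathrm i\phi}+\sum_{i=1}^M\big(c_{1,(i,i)}(\Omega)s_1^is_2^ie^{\mathrm i\phi}+d_{1,(i+1,i-1)}(\Omega)s_1^{i+1}s_2^{i-1}e^{-\mathrm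 i\phi}\big)\Big)$$ and its complex conjugate; here $\gamma_i$, $c_{1,\mathbf 0}$, $c_{1,(i,i)}(\Omega)$, $d_{1,(i+1,i-1)}(\Omega)$ are the resulting complex coefficients. Writing $s_1=\rho e^{\mathrm i\theta}$ and $\psi=\theta-\phi$ gives the reduced dynamics in $(\rho,\psi)$ stated in the claim, with $a(\rho)=\mathrm{Re}(\lambda_1)\rho+\sum_{i=1}^M\mathrm{Re}(\gamma_i)\rho^{2i+1}$, $b(\rho)=\mathrm{Im}(\lambda_1)+\sum_{i=1}^M\mathrm{Im}(\gamma_i)\rho^{2i}$, $f_1(\rho,\Omega)=\mathrm{Re}(c_{1,\mathbf 0})+\sum_{i=1}^M(\mathrm{Re}\,c_{1,(i,i)}(\Omega)+\mathrm{Re}\,d_{1,(i+1,i-1)}(\Omega))\rho^{2i}$, $f_2(\rho,\Omega)=\mathrm{Im}(c_{1,\mathbf 0})+\sum_{i=1}^M(\mathrm{Im}\,c_{1,(i,i)}(\Omega)-\mathrm{Im}\,d_{1,(i+1,i-1)}(\Omega))\rho^{2i}$, $g_1(\rho,\Omega)=\mathrm{Im}(c_{1,\mathbf 0})+\sum_{i=1}^M(\mathrm{Im}\,c_{1,(i,i)}(\Omega)+\mathrm{Im}\,d_{1,(i+1,i-1)}(\Omega))\rho^{2i}$, $g_2(\rho,\Omega)=\mathrm{Re}(c_{1,\mathbf 0})+\sum_{i=1}^M(\mathrm{Re}\,c_{1,(i,i)}(\Omega)-\mathrm{Re}\,d_{1,(i+1,i-1)}(\Omega))\rho^{2i}$.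 Fixed points $(\rho,\psi)$ of this system, i.e. solutions of $a+\varepsilon(f_1\cos\psi+f_2\sin\psi)=0$ and $(b-\Omega)\rho+\varepsilon(g_1\cos\psi-g_2\sin\psi)=0$, correspond to periodic solutions of the full mechanical system; these are the $T$-periodic orbits meant, $T=2\pi/\Omega$ being the forcing period, and $\rho$ is their amplitude.
   Formalization: The equivalence is stated for amplitudes ρ with a(ρ) ≠ ε f₁(ρ,Ω), where the denominator of K^± is nonzero; where they are equal K^± is undefined, and an orbit with ψ = π can exist there that the formula misses. *)

theory Defs
  imports Complex_Main
begin

text \<open>
  Coefficients of the reduced dynamics in the complex coordinate \<open>s\<^sub>1\<close>:
  \<open>lam\<close> is the eigenvalue \<open>\<lambda>\<^sub>1\<close>, \<open>gam i\<close> multiplies \<open>s\<^sub>1^(i+1) s\<^sub>2^i\<close>, and \<open>cfun i \<Omega>\<close>, \<open>dfun i \<Omega>\<close> are the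
  forcing coefficients with multi-index \<open>(i,i)\<close> and \<open>(i+1,i-1)\<close>; all are used for
  \<open>1 \<le> i \<le> Mord\<close> only. The coefficient \<open>c0\<close> of multi-index \<open>(0,0)\<close> does not depend on \<open>\<Omega>\<close>.
\<close>

record ssm_coeffs =
  Mord :: nat
  lam :: complex
  gam :: "nat \<Rightarrow> complex"
  c0 :: complex
  cfun :: "nat \<Rightarrow> real \<Rightarrow> complex"
  dfun :: "nat \<Rightarrow> real \<Rightarrow> complex"

definition afun :: "ssm_coeffs \<Rightarrow> real \<Rightarrow> real" where
  "afun S \<rho> = Re (lam S) * \<rho> + (\<Sum>i=1..Mord S. Re (gam S i) * \<rho> ^ (2 * i + 1))"

definition bfun :: "ssm_coeffs \<Rightarrow> real \<Rightarrow> real" where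
  "bfun S \<rho> = Im (lam S) + (\<Sum>i=1..Mord S. Im (gam S i) * \<rho> ^ (2 * i))"

definition f1 :: "ssm_coeffs \<Rightarrow> real \<Rightarrow> real \<Rightarrow> real" where
  "f1 S \<rho> \<Omega> = Re (c0 S) + (\<Sum>i=1..Mord S. (Re (cfun S i \<Omega>) + Re (dfun S i \<Omega>)) * \<rho> ^ (2 * i))"

definition f2 :: "ssm_coeffs \<Rightarrow> real \<Rightarrow> real \<Rightarrow> real" where
  "f2 S \<rho> \<Omega> = Im (c0 S) + (\<Sum>i=1..Mord S. (Im (cfun S i \<Omega>) - Im (dfun S i \<Omega>)) * \<rho> ^ (2 * i))"

definition g1 :: "ssm_coeffs \<Rightarrow> real \<Rightarrow> real \<Rightarrow> real" where
  "g1 S \<rho> \<Omega> = Im (c0 S) + (\<Sum>i=1..Mord S. (Im (cfun S i \<Omega>) + Im (dfun S i \<Omega>)) * \<rho> ^ (2 * i))"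

definition g2 :: "ssm_coeffs \<Rightarrow> real \<Rightarrow> real \<Rightarrow> real" where
  "g2 S \<rho> \<Omega> = Re (c0 S) + (\<Sum>i=1..Mord S. (Re (cfun S i \<Omega>) - Re (dfun S i \<Omega>)) * \<rho> ^ (2 * i))"

text \<open>
  The polar system is singular at \<open>\<rho> = 0\<close>, so its solutions are required to stay in \<open>\<rho> > 0\<close>.
\<close>

definition reduced_solution ::
    "ssm_coeffs \<Rightarrow> real \<Rightarrow> real \<Rightarrow> (real \<Rightarrow> real) \<Rightarrow> (real \<Rightarrow> real) \<Rightarrow> bool" where
  "reduced_solution S \<epsilon> \<Omega> r p \<longleftrightarrow>
     (\<forall>t. 0 < r t
        \<and> (r has_real_derivative
             afun S (r t) + \<epsilon> * (f1 S (r t) \<Omega> * cos (p t) + f2 S (r t) \<Omega> * sin (p t))) (at t)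
        \<and> (p has_real_derivative
             (bfun S (r t) - \<Omega>)
               + \<epsilon> / r t * (g1 S (r t) \<Omega> * cos (p t) - g2 S (r t) \<Omega> * sin (p t))) (at t))"

text \<open>
  The phase is \<open>\<psi> = \<theta> - \<Omega> t\<close>, so a fixed point \<open>(\<rho>, \<psi>)\<close> is the orbit
  \<open>s\<^sub>1 t = \<rho> * cis (\<Omega> * t + \<psi>)\<close>, which has constant amplitude \<open>\<rho>\<close> and period \<open>2 * pi / \<Omega>\<close>.
  The phase equation is multiplied by \<open>\<rho>\<close>, so that \<open>\<rho> = 0\<close> is meaningful.
\<close>

definition fixed_point :: "ssm_coeffs \<Rightarrow> real \<Rightarrow> real \<Rightarrow> real \<Rightarrow> real \<Rightarrow> bool" where
  "fixed_point S \<epsilon> \<Omega> \<rho> \<psi> \<longleftrightarrow>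
     afun S \<rho> + \<epsilon> * (f1 S \<rho> \<Omega> * cos \<psi> + f2 S \<rho> \<Omega> * sin \<psi>) = 0 \<and>
     (bfun S \<rho> - \<Omega>) * \<rho> + \<epsilon> * (g1 S \<rho> \<Omega> * cos \<psi> - g2 S \<rho> \<Omega> * sin \<psi>) = 0"

definition radicand :: "ssm_coeffs \<Rightarrow> real \<Rightarrow> real \<Rightarrow> real \<Rightarrow> real" where
  "radicand S \<epsilon> \<rho> \<Omega> = \<epsilon>\<^sup>2 * ((f1 S \<rho> \<Omega>)\<^sup>2 + (f2 S \<rho> \<Omega>)\<^sup>2) - (afun S \<rho>)\<^sup>2"

text \<open>
  The sign \<open>\<sigma>\<close>, which is \<open>1\<close> or \<open>-1\<close>, selects the branch. As a real-valued function a branch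
  is defined only where \<open>afun S \<rho> \<noteq> \<epsilon> * f1 S \<rho> \<Omega>\<close> and \<open>0 \<le> radicand S \<epsilon> \<rho> \<Omega>\<close>; elsewhere the
  HOL term has a value without meaning, so users have to state these conditions.
\<close>

definition Kfun :: "real \<Rightarrow> ssm_coeffs \<Rightarrow> real \<Rightarrow> real \<Rightarrow> real \<Rightarrow> real" where
  "Kfun \<sigma> S \<epsilon> \<rho> \<Omega> =
     (- \<epsilon> * f2 S \<rho> \<Omega> + \<sigma> * sqrt (radicand S \<epsilon> \<rho> \<Omega>)) / (afun S \<rho> - \<epsilon> * f1 S \<rho> \<Omega>)"

definition Gfun :: "real \<Rightarrow> ssm_coeffs \<Rightarrow> real \<Rightarrow> real \<Rightarrow> real \<Rightarrow> real" where
  "Gfun \<sigma> S \<epsilon> \<rho> \<Omega> =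
     (bfun S \<rho> - \<Omega>) * \<rho>
     + \<epsilon> * (g1 S \<rho> \<Omega> * ((1 - (Kfun \<sigma> S \<epsilon> \<rho> \<Omega>)\<^sup>2) / (1 + (Kfun \<sigma> S \<epsilon> \<rho> \<Omega>)\<^sup>2))
            - g2 S \<rho> \<Omega> * (2 * Kfun \<sigma> S \<epsilon> \<rho> \<Omega> / (1 + (Kfun \<sigma> S \<epsilon> \<rho> \<Omega>)\<^sup>2)))"

end

theory Submission
  imports Defs
begin

text \<open>
  Under the half-angle substitution \<open>K = tan (\<psi>/2)\<close> the amplitude equation becomes the quadratic
  \<open>(a - \<epsilon> f1) K\<^sup>2 + 2 \<epsilon> f2 K + (a + \<epsilon> f1) = 0\<close>, whose real roots are the two branches \<open>K\<^sup>\<plusminus>\<close>, and the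
  phase equation becomes \<open>G = 0\<close>. The substitution misses only the angle \<open>\<psi> = \<pi>\<close>, which solves
  the amplitude equation exactly when \<open>a = \<epsilon> f1\<close>.
\<close>

text \<open>Stereographic projection from \<open>(-1, 0)\<close> identifies the rest of the unit
  circle with the real line; the hypothesis excludes the centre of projection.\<close>

lemma ex_angle_iff_ex_half_angle_tangent:
  fixes P :: "real \<Rightarrow> real \<Rightarrow> bool"
  assumes "\<not> P (- 1) 0"
  shows "(\<exists>\<psi>. P (cos \<psi>) (sin \<psi>)) \<longleftrightarrow> (\<exists>K. P ((1 - K\<^sup>2) / (1 + K\<^sup>2)) (2 * K / (1 + K\<^sup>2)))"
proof
  assume "\<exists>\<psi>. P (cos \<psi>) (sin \<psi>)"
  then obtain \<psi> where \<psi>: "P (cos \<psi>) (sin \<psi>)" by blast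
  define c s where "c = cos \<psi>" and "s = sin \<psi>"
  have circle: "s\<^sup>2 = (1 - c) * (1 + c)"
    using sin_cos_squared_add[of \<psi>] by (simp add: c_def s_def power2_eq_square algebra_simps)
  have nz: "1 + c \<noteq> 0"
  proof
    assume "1 + c = 0"
    then have "c = - 1" and "s = 0" using circle by auto
    then show False using \<psi> assms by (simp add: c_def s_def)
  qed
  \<comment> \<open>The slope of the line from \<open>(-1, 0)\<close> to \<open>(c, s)\<close>,
    which is the tangent of \<open>\<psi> / 2\<close>.\<close>
  define K where "K = s / (1 + c)"
  have "K\<^sup>2 = (1 - c) / (1 + c)"
    unfolding K_def power_divide circle using nz by (simp add: power2_eq_square)
  then have "1 + K\<^sup>2 = 2 / (1 + c)" "1 - K\<^sup>2 = 2 * c / (1 + c)"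
    using nz by (simp_all add: field_simps)
  then have "(1 - K\<^sup>2) / (1 + K\<^sup>2) = c" "2 * K / (1 + K\<^sup>2) = s"
    using nz by (simp_all add: K_def)
  then show "\<exists>K. P ((1 - K\<^sup>2) / (1 + K\<^sup>2)) (2 * K / (1 + K\<^sup>2))"
    using \<psi> unfolding c_def s_def by metis
next
  assume "\<exists>K. P ((1 - K\<^sup>2) / (1 + K\<^sup>2)) (2 * K / (1 + K\<^sup>2))"
  then obtain K where K: "P ((1 - K\<^sup>2) / (1 + K\<^sup>2)) (2 * K / (1 + K\<^sup>2))" by blast
  have pos: "1 + K\<^sup>2 \<noteq> 0" by (smt (verit) zero_le_power2)
  have "(1 - K\<^sup>2)\<^sup>2 + (2 * K)\<^sup>2 = (1 + K\<^sup>2)\<^sup>2" by algebra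
  then have "((1 - K\<^sup>2) / (1 + K\<^sup>2))\<^sup>2 + (2 * K / (1 + K\<^sup>2))\<^sup>2 = 1"
    using pos by (simp add: power_divide flip: add_divide_distrib)
  then obtain \<psi> where "(1 - K\<^sup>2) / (1 + K\<^sup>2) = cos \<psi>" "2 * K / (1 + K\<^sup>2) = sin \<psi>"
    using sincos_total_2pi by metis
  with K show "\<exists>\<psi>. P (cos \<psi>) (sin \<psi>)" by metis
qed

text \<open>Completing the square. Writing the linear coefficient as \<open>2 * h\<close> removes
  the factor 4 from the discriminant. Its sign is stated explicitly because \<open>sqrt\<close> is
  also a real number at negative arguments, where the formula gives no root.\<close>

lemma quadratic_even_middle_iff:
  fixes a h c x :: real
  assumes "a \<noteq> 0"
  shows "a * x\<^sup>2 + 2 * h * x + c = 0 \<longleftrightarrow>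
    0 \<le> h\<^sup>2 - a * c \<and> (\<exists>\<sigma>\<in>{1, -1}. x = (- h + \<sigma> * sqrt (h\<^sup>2 - a * c)) / a)"
proof -
  have square: "y\<^sup>2 = D \<longleftrightarrow> 0 \<le> D \<and> (y = sqrt D \<or> y = - sqrt D)" for y D :: real
    by (auto simp: abs_if)
  \<comment> \<open>Multiplying by \<open>a\<close> makes the left-hand side
    \<open>(a * x + h)\<^sup>2 - (h\<^sup>2 - a * c)\<close>.\<close>
  have "a * x\<^sup>2 + 2 * h * x + c = 0 \<longleftrightarrow> a * (a * x\<^sup>2 + 2 * h * x + c) = 0"
    using assms by simp
  also have "\<dots> \<longleftrightarrow> (a * x + h)\<^sup>2 = h\<^sup>2 - a * c"
    by (simp add: power2_eq_square algebra_simps)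
  also have "\<dots> \<longleftrightarrow> 0 \<le> h\<^sup>2 - a * c \<and>
      (a * x + h = sqrt (h\<^sup>2 - a * c) \<or> a * x + h = - sqrt (h\<^sup>2 - a * c))"
    by (rule square)
  also have "\<dots> \<longleftrightarrow> 0 \<le> h\<^sup>2 - a * c \<and> (\<exists>\<sigma>\<in>{1, -1}. x = (- h + \<sigma> * sqrt (h\<^sup>2 - a * c)) / a)"
    using assms by (auto simp: eq_divide_eq algebra_simps)
  finally show ?thesis .
qed

text \<open>An equivalence for each single \<open>K\<close>, so that it can be rewritten under the
  quantifier over \<open>K\<close>. The assumption says that the leading coefficient of the
  quadratic is nonzero.\<close>

lemma amplitude_equation_half_angle_iff:
  assumes "afun S \<rho> \<noteq> \<epsilon> * f1 S \<rho> \<Omega>"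
  shows "afun S \<rho> + \<epsilon> * (f1 S \<rho> \<Omega> * ((1 - K\<^sup>2) / (1 + K\<^sup>2)) + f2 S \<rho> \<Omega> * (2 * K / (1 + K\<^sup>2))) = 0
    \<longleftrightarrow> 0 \<le> radicand S \<epsilon> \<rho> \<Omega> \<and> (\<exists>\<sigma>\<in>{1, -1}. K = Kfun \<sigma> S \<epsilon> \<rho> \<Omega>)"
proof -
  let ?a = "afun S \<rho>" and ?f = "\<epsilon> * f1 S \<rho> \<Omega>" and ?h = "\<epsilon> * f2 S \<rho> \<Omega>"
  have pos: "1 + K\<^sup>2 \<noteq> 0" by (smt (verit) zero_le_power2)
  have rad: "?h\<^sup>2 - (?a - ?f) * (?a + ?f) = radicand S \<epsilon> \<rho> \<Omega>"
    by (simp add: radicand_def power2_eq_square algebra_simps)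
  have "?a + \<epsilon> * (f1 S \<rho> \<Omega> * ((1 - K\<^sup>2) / (1 + K\<^sup>2)) + f2 S \<rho> \<Omega> * (2 * K / (1 + K\<^sup>2)))
      = ((?a - ?f) * K\<^sup>2 + 2 * ?h * K + (?a + ?f)) / (1 + K\<^sup>2)"
    using pos by (simp add: divide_simps) (simp add: algebra_simps)
  then show ?thesis
    using quadratic_even_middle_iff[of "?a - ?f" K ?h "?a + ?f"] assms pos
    unfolding rad Kfun_def by simp
qed

text \<open>Both equations must hold at the same point of the circle, hence for the same
  \<open>K\<close>. The first confines \<open>K\<close> to the two branches; inserting a branch into
  the second gives \<open>Gfun\<close>.\<close>

lemma ex_fixed_point_iff:
  assumes "afun S \<rho> \<noteq> \<epsilon> * f1 S \<rho> \<Omega>"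
  shows "(\<exists>\<psi>. fixed_point S \<epsilon> \<Omega> \<rho> \<psi>) \<longleftrightarrow>
    0 \<le> radicand S \<epsilon> \<rho> \<Omega> \<and> (\<exists>\<sigma>\<in>{1, -1}. Gfun \<sigma> S \<epsilon> \<rho> \<Omega> = 0)"
proof -
  define P where "P c s \<longleftrightarrow> afun S \<rho> + \<epsilon> * (f1 S \<rho> \<Omega> * c + f2 S \<rho> \<Omega> * s) = 0 \<and>
     (bfun S \<rho> - \<Omega>) * \<rho> + \<epsilon> * (g1 S \<rho> \<Omega> * c - g2 S \<rho> \<Omega> * s) = 0" for c s
  \<comment> \<open>At \<open>\<psi> = pi\<close> the amplitude equation would force
    \<open>afun S \<rho> = \<epsilon> * f1 S \<rho> \<Omega>\<close>.\<close>
  have "\<not> P (- 1) 0" using assms by (simp add: P_def)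
  then have "(\<exists>\<psi>. fixed_point S \<epsilon> \<Omega> \<rho> \<psi>) \<longleftrightarrow>
      (\<exists>K. P ((1 - K\<^sup>2) / (1 + K\<^sup>2)) (2 * K / (1 + K\<^sup>2)))"
    unfolding fixed_point_def P_def[symmetric] by (rule ex_angle_iff_ex_half_angle_tangent)
  then show ?thesis
    unfolding P_def amplitude_equation_half_angle_iff[OF assms] Gfun_def by blast
qed

text \<open>By uniqueness of derivatives, a constant pair solves the system exactly when both
  right-hand sides vanish; multiplying the phase equation by \<open>\<rho> > 0\<close> is
  reversible.\<close>

lemma constant_reduced_solution_iff_fixed_point:
  assumes "0 < \<rho>"
  shows "reduced_solution S \<epsilon> \<Omega> (\<lambda>_. \<rho>) (\<lambda>_. \<psi>) \<longleftrightarrow> fixed_point S \<epsilon> \<Omega> \<rho> \<psi>"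
proof -
  have const: "((\<lambda>_. x) has_real_derivative D) (at t) \<longleftrightarrow> D = 0" for x D t :: real
    using DERIV_unique DERIV_const by blast
  have "B + \<epsilon> / \<rho> * C = 0 \<longleftrightarrow> B * \<rho> + \<epsilon> * C = 0" for B C
    using assms by (simp add: field_simps)
  then show ?thesis
    using assms by (simp add: reduced_solution_def fixed_point_def const)
qed

text \<open>The second equivalence transfers the first from algebraic fixed points to constant
  solutions of the polar system, which is possible only away from its singularity at
  \<open>\<rho> = 0\<close>.\<close>

theorem theorem3:
  fixes S :: ssm_coeffs and \<epsilon> \<Omega> \<rho> :: real
  assumes "Re (lam S) < 0" and "0 \<le> \<epsilon>" and "0 < \<Omega>" and "0 \<le> \<rho>"
    and "afun S \<rho> \<noteq> \<epsilon> * f1 S \<rho> \<Omega>"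
  shows "((\<exists>\<psi>. fixed_point S \<epsilon> \<Omega> \<rho> \<psi>) \<longleftrightarrow>
            0 \<le> radicand S \<epsilon> \<rho> \<Omega> \<and> (\<exists>\<sigma>\<in>{1, -1}. Gfun \<sigma> S \<epsilon> \<rho> \<Omega> = 0))
       \<and> (0 < \<rho> \<longrightarrow>
           ((\<exists>\<psi>. reduced_solution S \<epsilon> \<Omega> (\<lambda>_. \<rho>) (\<lambda>_. \<psi>)) \<longleftrightarrow>
            0 \<le> radicand S \<epsilon> \<rho> \<Omega> \<and> (\<exists>\<sigma>\<in>{1, -1}. Gfun \<sigma> S \<epsilon> \<rho> \<Omega> = 0)))"
  using ex_fixed_point_iff[OF assms(5)]
  by (simp add: constant_reduced_solution_iff_fixed_point)

end
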